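(* Let $A\in\mathbb{R}^{n\times n}$ satisfy $A^\top=-A$ and be cyclic. Let $i\omega_1,\ldots,i\omega_n$ be the (pairwise distinct) complex eigenvalues of $A$, with $\omega_j\in\mathbb{R}$, and set $$C_A=\max_{1\leq j\leq n}\sum_{k\neq j}\frac{2}{\vert\omega_j-\omega_k\vert}.$$ Then, for every $T>0$, $\rho_1(A,T)\geq\max\{0,1-\frac{C_A}{T}\}$. In particular, $1-\rho_1(A,T)=\mathrm{O}(T^{-1})$ as $T\to+\infty$.
   Context: $G_T(A,b)=\int_0^Te^{tA}bb^\top e^{tA^\top}\,dt$, $\gamma_1(A,T)=\max_{\Vert b\Vert=1}\lambda_{\min}(G_T(A,b))$ over $b\in\mathbb{R}^n$, $\gamma_{\mathrm{rel}}(A,T)=\max_{X\succeq0,\ \operatorname{tr}X=1}\lambda_{\min}\big(\int_0^Te^{tA}Xe^{tA^\top}dt\big)$ over real symmetric $X$, and $\rho_1(A,T)=\gamma_1(A,T)/\gamma_{\mathrm{rel}}(A,T)$. $A$ is cyclic if $\operatorname{span}(b,Ab,\ldots,A^{n-1}b)=\mathbb{R}^n$ for some $b\in\mathbb{R}^n$; for real skew-symmetric $A$ this is equivalent to simplicity of the complex spectrum. *)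

theory Defs
  imports "HOL-Analysis.Analysis" "HOL-Library.Landau_Symbols"
begin

text \<open>
  The type \<open>real ^ 'n ^ 'n\<close> carries the componentwise product as its ring multiplication, so
  powers of a matrix are written as iterates of \<open>(**)\<close> or \<open>(*v)\<close>.
\<close>

definition mexp :: "real ^ 'n ^ 'n \<Rightarrow> real ^ 'n ^ 'n" where
  "mexp A = (\<Sum>k. (1 / fact k) *\<^sub>R (((**) A ^^ k) (mat 1)))"

definition cyclic_matrix :: "real ^ 'n ^ 'n \<Rightarrow> bool" where
  "cyclic_matrix A \<longleftrightarrow> (\<exists>b. span {((*v) A ^^ k) b |k. k < CARD('n)} = UNIV)"

definition eigenvalues :: "'a::field ^ 'n ^ 'n \<Rightarrow> 'a set" where
  "eigenvalues M = {l. \<exists>v. v \<noteq> 0 \<and> M *v v = l *s v}"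

text \<open>Meaningful for symmetric matrices only, whose real spectrum is nonempty.\<close>

definition lambda_min :: "real ^ 'n ^ 'n \<Rightarrow> real" where
  "lambda_min M = Min (eigenvalues M)"

definition psd :: "real ^ 'n ^ 'n \<Rightarrow> bool" where
  "psd X \<longleftrightarrow> transpose X = X \<and> (\<forall>v. 0 \<le> v \<bullet> (X *v v))"

definition outer :: "real ^ 'n \<Rightarrow> real ^ 'n ^ 'n" where
  "outer b = (\<chi> i j. b $ i * b $ j)"

definition gramian :: "real ^ 'n ^ 'n \<Rightarrow> real ^ 'n ^ 'n \<Rightarrow> real \<Rightarrow> real ^ 'n ^ 'n" where
  "gramian A X T = integral {0..T} (\<lambda>t. mexp (t *\<^sub>R A) ** X ** mexp (t *\<^sub>R transpose A))"

text \<open>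
  \<open>GREATEST\<close> is a maximum and not a supremum: its value is only determined once the maximum
  is shown to be attained.
\<close>

definition gamma1 :: "real ^ 'n ^ 'n \<Rightarrow> real \<Rightarrow> real" where
  "gamma1 A T = (GREATEST g. \<exists>b. norm b = 1 \<and> g = lambda_min (gramian A (outer b) T))"

definition gamma_rel :: "real ^ 'n ^ 'n \<Rightarrow> real \<Rightarrow> real" where
  "gamma_rel A T = (GREATEST g. \<exists>X. psd X \<and> trace X = 1 \<and> g = lambda_min (gramian A X T))"

definition rho1 :: "real ^ 'n ^ 'n \<Rightarrow> real \<Rightarrow> real" where
  "rho1 A T = gamma1 A T / gamma_rel A T"

definition gap_const :: "('n::finite \<Rightarrow> real) \<Rightarrow> real" where
  "gap_const \<omega> = Max (range (\<lambda>j. \<Sum>k \<in> UNIV - {j}. 2 / \<bar>\<omega> j - \<omega> k\<bar>))"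

end

theory Submission
  imports Defs "HOL-Computational_Algebra.Fundamental_Theorem_Algebra"
begin

text \<open>
  Cyclicity makes the spectrum simple: a polynomial of degree \<open>n\<close> annihilates the cyclic vector and
  no smaller one does, its roots are eigenvalues, and skewness excludes double roots. In the
  orthonormal eigenbasis \<open>u\<^sub>j\<close> the exponentials are unitary and diagonal. Hence every Gramian with
  \<open>tr X = 1\<close> has trace \<open>T\<close>, and \<open>X = I / n\<close> shows that the relaxed optimum is \<open>T / n\<close>. For the
  lower bound take a unit vector \<open>b\<close> with \<open>|<u\<^sub>j, b>|\<^sup>2 = 1 / n\<close> for all \<open>j\<close>; then the quadratic form of
  its Gramian is \<open>\<integral> |\<Sum> d\<^sub>j exp (i \<omega>\<^sub>j t)|\<^sup>2 dt\<close> with \<open>\<Sum> |d\<^sub>j|\<^sup>2 = |x|\<^sup>2 / n\<close>, whose off-diagonal terms are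
  at most \<open>2 |d\<^sub>j| |d\<^sub>k| / |\<omega>\<^sub>j - \<omega>\<^sub>k|\<close> and are absorbed by the inequality of arithmetic and geometric
  means.
\<close>

subsection \<open>The least eigenvalue of a symmetric matrix\<close>

lemma symmetric_matrix_inner:
  fixes M :: "real ^ 'n ^ 'n"
  assumes "transpose M = M"
  shows "(M *v x) \<bullet> y = x \<bullet> (M *v y)"
  by (metis assms dot_lmul_matrix transpose_matrix_vector)

text \<open>Choosing one eigenvector per eigenvalue yields pairwise orthogonal nonzero vectors;
  these are independent, hence finitely many. The \<open>Min\<close> in \<open>lambda_min\<close>
  needs this finiteness.\<close>

lemma finite_eigenvalues_symmetric:
  fixes M :: "real ^ 'n ^ 'n"
  assumes sym: "transpose M = M"
  shows "finite (eigenvalues M)"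
proof -
  have "\<forall>l\<in>eigenvalues M. \<exists>v. v \<noteq> 0 \<and> M *v v = l *\<^sub>R v"
    by (auto simp: eigenvalues_def scalar_mult_eq_scaleR)
  then obtain f where f: "\<And>l. l \<in> eigenvalues M \<Longrightarrow> f l \<noteq> 0 \<and> M *v f l = l *\<^sub>R f l"
    by metis
  have orth: "f k \<bullet> f l = 0" if "k \<in> eigenvalues M" "l \<in> eigenvalues M" "k \<noteq> l" for k l
    using symmetric_matrix_inner[OF sym, of "f k" "f l"] f[OF that(1)] f[OF that(2)] that(3)
    by simp
  have inj: "inj_on f (eigenvalues M)"
    by (rule inj_onI) (metis orth f inner_eq_zero_iff)
  have "independent (f ` eigenvalues M)"
  proof (rule pairwise_orthogonal_independent)
    show "pairwise orthogonal (f ` eigenvalues M)"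
      unfolding pairwise_def orthogonal_def using orth by auto
    show "0 \<notin> f ` eigenvalues M" using f by force
  qed
  then have "finite (f ` eigenvalues M)" by (rule finiteI_independent)
  then show ?thesis using inj finite_imageD by blast
qed

text \<open>A minimiser \<open>v\<close> of the quadratic form on the compact unit sphere is an
  eigenvector, since otherwise the residual \<open>w = M v - m v\<close> would supply a direction of
  descent. Testing with eigenvectors shows that no eigenvalue lies below \<open>m\<close>.\<close>

lemma lambda_min_rayleigh:
  fixes M :: "real ^ 'n ^ 'n"
  assumes sym: "transpose M = M"
  obtains v where "norm v = 1" "lambda_min M = v \<bullet> (M *v v)"
    "\<And>x. lambda_min M * (x \<bullet> x) \<le> x \<bullet> (M *v x)"
proof -
  have "continuous_on (sphere 0 1) (\<lambda>x. x \<bullet> (M *v x))"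
    by (intro continuous_intros linear_continuous_on matrix_vector_mul_bounded_linear)
  \<comment> \<open>A coordinate vector at an arbitrary index witnesses that the sphere is
    nonempty.\<close>
  moreover have "axis undefined 1 \<in> sphere (0 :: real ^ 'n) 1"
    by (simp add: norm_axis_1)
  ultimately obtain v :: "real ^ 'n" where v: "norm v = 1"
    and least: "\<And>y. norm y = 1 \<Longrightarrow> v \<bullet> (M *v v) \<le> y \<bullet> (M *v y)"
    using continuous_attains_inf[of "sphere (0 :: real ^ 'n) 1" "\<lambda>x. x \<bullet> (M *v x)"] by fastforce
  define m where "m = v \<bullet> (M *v v)"
  have low: "m * (x \<bullet> x) \<le> x \<bullet> (M *v x)" for x
  proof (cases "x = 0")
    case False
    then have "m \<le> (x /\<^sub>R norm x) \<bullet> (M *v (x /\<^sub>R norm x))"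
      unfolding m_def by (intro least) simp
    also have "\<dots> = (x \<bullet> (M *v x)) / (norm x)\<^sup>2"
      by (simp add: matrix_vector_mult_scaleR power2_eq_square field_simps)
    finally show ?thesis using False
      by (simp add: power2_norm_eq_inner pos_le_divide_eq)
  qed simp
  define w where "w = M *v v - m *\<^sub>R v"
  \<comment> \<open>This expands the nonnegative excess of the form over \<open>m\<close> times the
    squared norm at \<open>v + t w\<close>. The constant term vanishes, and the linear coefficient
    is \<open>2 (w \<bullet> w)\<close>.\<close>
  have quad: "0 \<le> (2 * t) * (w \<bullet> w) + t\<^sup>2 * (w \<bullet> (M *v w) - m * (w \<bullet> w))" for t
  proof -
    have "(v + t *\<^sub>R w) \<bullet> (M *v (v + t *\<^sub>R w)) - m * ((v + t *\<^sub>R w) \<bullet> (v + t *\<^sub>R w))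
        = (v \<bullet> (M *v v) - m * (v \<bullet> v)) + 2 * t * (w \<bullet> (M *v v) - m * (w \<bullet> v))
          + t\<^sup>2 * (w \<bullet> (M *v w) - m * (w \<bullet> w))"
      using symmetric_matrix_inner[OF sym, of v w]
      by (simp add: matrix_vector_mult_scaleR matrix_vector_right_distrib inner_add_left
          inner_add_right inner_commute algebra_simps power2_eq_square)
    moreover have "v \<bullet> v = 1" using v by (simp add: norm_eq_1)
    moreover have "w \<bullet> (M *v v) - m * (w \<bullet> v) = w \<bullet> w"
      by (simp add: w_def inner_diff_right inner_diff_left)
    ultimately show ?thesis using low[of "v + t *\<^sub>R w"] by (simp add: m_def)
  qed
  have "w \<bullet> w = 0"
  proof (rule ccontr)
    assume "w \<bullet> w \<noteq> 0"
    then have pos: "0 < w \<bullet> w" by simp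
    define q where "q = w \<bullet> (M *v w) - m * (w \<bullet> w)"
    have q0: "0 \<le> q" using low[of w] by (simp add: q_def)
    \<comment> \<open>The exact minimiser of the quadratic would have denominator \<open>q\<close>;
      taking \<open>q + 1\<close> also covers \<open>q = 0\<close> and still makes the value
      negative.\<close>
    define t where "t = - (w \<bullet> w) / (q + 1)"
    have "2 * t * (w \<bullet> w) + t\<^sup>2 * q = - (w \<bullet> w)\<^sup>2 * (q + 2) / (q + 1)\<^sup>2"
      using q0 by (simp add: t_def divide_simps power2_eq_square) (simp add: algebra_simps)
    also have "\<dots> < 0" using pos q0 by (simp add: divide_less_0_iff)
    finally show False using quad[of t] by (simp add: q_def)
  qed
  then have "M *v v = m *s v" by (simp add: w_def scalar_mult_eq_scaleR)
  then have mem: "m \<in> eigenvalues M"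
    unfolding eigenvalues_def using v by (intro CollectI exI[of _ v]) auto
  have "lambda_min M = m"
    unfolding lambda_min_def
  proof (rule Min_eqI[OF finite_eigenvalues_symmetric[OF sym] _ mem])
    fix l assume "l \<in> eigenvalues M"
    then obtain y where y: "y \<noteq> 0" "M *v y = l *\<^sub>R y"
      by (auto simp: eigenvalues_def scalar_mult_eq_scaleR)
    then show "m \<le> l" using low[of y] by simp
  qed
  then show ?thesis using that[of v] v low m_def by simp
qed

text \<open>Each diagonal entry is the quadratic form at a unit coordinate vector, so the Rayleigh
  bound applies to it.\<close>

lemma lambda_min_le_trace:
  fixes M :: "real ^ 'n ^ 'n"
  assumes "transpose M = M"
  shows "real CARD('n) * lambda_min M \<le> trace M"
proof -
  obtain v where low: "\<And>x. lambda_min M * (x \<bullet> x) \<le> x \<bullet> (M *v x)"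
    using lambda_min_rayleigh[OF assms] by blast
  have "(\<Sum>i\<in>(UNIV :: 'n set). lambda_min M) \<le> (\<Sum>i\<in>UNIV. M $ i $ i)"
  proof (rule sum_mono)
    fix i
    show "lambda_min M \<le> M $ i $ i"
      using low[of "axis i 1"] by (simp add: matrix_vector_mult_basis column_def inner_axis' inner_axis)
  qed
  then show ?thesis by (simp add: trace_def)
qed

lemma lambda_min_scaleR_mat: "lambda_min (c *\<^sub>R mat 1 :: real ^ 'n ^ 'n) = c"
proof -
  have "transpose (c *\<^sub>R mat 1 :: real ^ 'n ^ 'n) = c *\<^sub>R mat 1"
    by (simp add: vec_eq_iff transpose_def mat_def)
  from lambda_min_rayleigh[OF this] obtain v :: "real ^ 'n"
    where v: "norm v = 1" "lambda_min (c *\<^sub>R mat 1 :: real ^ 'n ^ 'n) = v \<bullet> ((c *\<^sub>R mat 1) *v v)" .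
  then show ?thesis by (simp add: scaleR_matrix_vector_assoc[symmetric] norm_eq_1)
qed

lemma outer_quadratic: "v \<bullet> (outer b *v v) = (b \<bullet> v)\<^sup>2"
proof -
  have "outer b *v v = (b \<bullet> v) *\<^sub>R b"
    by (simp add: vec_eq_iff outer_def matrix_vector_mult_def inner_vec_def sum_distrib_left mult_ac)
  then show ?thesis by (simp add: power2_eq_square inner_commute)
qed

lemma psd_outer: "psd (outer b)"
  unfolding psd_def outer_quadratic by (simp add: vec_eq_iff transpose_def outer_def mult.commute)

lemma trace_outer: "trace (outer b) = (norm b)\<^sup>2"
  by (simp add: trace_def outer_def power2_norm_eq_inner inner_vec_def)

subsection \<open>Trigonometric sums with separated frequencies\<close>

lemma has_integral_cis_mult:
  fixes a T :: real
  assumes "a \<noteq> 0" "0 \<le> T"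
  shows "((\<lambda>t. cis (a * t)) has_integral (cis (a * T) - 1) / (\<i> * of_real a)) {0..T}"
proof -
  have "((\<lambda>t. cis (a * t) / (\<i> * of_real a)) has_vector_derivative cis (a * t)) (at t within {0..T})" for t
  proof -
    have "((\<lambda>z. exp (\<i> * of_real a * z) / (\<i> * of_real a)) has_field_derivative
            exp (\<i> * of_real a * of_real t)) (at (of_real t))"
      using assms(1) by (auto intro!: derivative_eq_intros)
    from has_vector_derivative_real_field[OF this]
    show ?thesis by (simp add: cis_conv_exp algebra_simps)
  qed
  from fundamental_theorem_of_calculus[OF assms(2) this]
  show ?thesis by (simp add: diff_divide_distrib)
qed

text \<open>After expanding the square, the diagonal contributes \<open>T\<close>, while every
  off-diagonal integral stays bounded in \<open>T\<close> by the inverse frequency gap. Splitting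
  each product \<open>|d j| |d k|\<close> evenly between its two squares leaves a row sum of gaps,
  as in diagonal dominance.\<close>

lemma trig_sum_integral_lower_bound:
  fixes \<omega> :: "'n::finite \<Rightarrow> real" and d :: "'n \<Rightarrow> complex"
  assumes inj: "inj \<omega>" and T: "0 \<le> T"
  shows "(T - gap_const \<omega>) * (\<Sum>j\<in>UNIV. (cmod (d j))\<^sup>2)
    \<le> integral {0..T} (\<lambda>t. (cmod (\<Sum>j\<in>UNIV. d j * cis (\<omega> j * t)))\<^sup>2)"
proof -
  define a where "a = (\<lambda>j k. d j * cnj (d k))"
  \<comment> \<open>\<open>J j k\<close> is the integral of
    \<open>cis ((\<omega> j - \<omega> k) * t)\<close> over \<open>{0..T}\<close>; below,
    \<open>g j k\<close> bounds its modulus off the diagonal.\<close>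
  define J where "J = (\<lambda>j k. if j = k then of_real T
      else (cis ((\<omega> j - \<omega> k) * T) - 1) / (\<i> * of_real (\<omega> j - \<omega> k)))"
  define g where "g = (\<lambda>j k. 2 / \<bar>\<omega> j - \<omega> k\<bar>)"
  have sq: "complex_of_real ((cmod (\<Sum>j\<in>UNIV. d j * cis (\<omega> j * t)))\<^sup>2)
      = (\<Sum>j\<in>UNIV. \<Sum>k\<in>UNIV. a j k * cis ((\<omega> j - \<omega> k) * t))" for t
    unfolding complex_norm_square cnj_sum sum_product a_def
    by (intro sum.cong refl) (simp add: cis_cnj cis_mult algebra_simps)
  have int: "((\<lambda>t. cis ((\<omega> j - \<omega> k) * t)) has_integral J j k) {0..T}" for j k
  proof (cases "j = k")
    case True
    then show ?thesis using T has_integral_const_real[of "1::complex" 0 T]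
      by (simp add: J_def scaleR_conv_of_real)
  next
    case False
    then have "\<omega> j - \<omega> k \<noteq> 0" using inj by (simp add: inj_eq)
    from has_integral_cis_mult[OF this T] False show ?thesis by (simp add: J_def)
  qed
  have "((\<lambda>t. complex_of_real ((cmod (\<Sum>j\<in>UNIV. d j * cis (\<omega> j * t)))\<^sup>2))
      has_integral (\<Sum>j\<in>UNIV. \<Sum>k\<in>UNIV. a j k * J j k)) {0..T}"
    unfolding sq by (intro has_integral_sum has_integral_mult_right int) auto
  from has_integral_linear[OF this bounded_linear_Re]
  have "integral {0..T} (\<lambda>t. (cmod (\<Sum>j\<in>UNIV. d j * cis (\<omega> j * t)))\<^sup>2)
      = Re (\<Sum>j\<in>UNIV. \<Sum>k\<in>UNIV. a j k * J j k)"
    by (simp add: o_def integral_unique)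
  also have "\<dots> = (\<Sum>j\<in>UNIV. Re (a j j * J j j) + (\<Sum>k\<in>UNIV - {j}. Re (a j k * J j k)))"
    unfolding Re_sum by (intro sum.cong refl sum.remove) auto
  also have "\<dots> \<ge> (\<Sum>j\<in>UNIV. T * (cmod (d j))\<^sup>2 -
      (\<Sum>k\<in>UNIV - {j}. g j k * ((cmod (d j))\<^sup>2 + (cmod (d k))\<^sup>2) / 2))"
  proof (rule sum_mono)
    fix j
    have "Re (a j j * J j j) = T * (cmod (d j))\<^sup>2"
      by (simp add: a_def J_def complex_mult_cnj cmod_power2)
    moreover have "- (g j k * ((cmod (d j))\<^sup>2 + (cmod (d k))\<^sup>2) / 2) \<le> Re (a j k * J j k)"
      if "k \<noteq> j" for k
    proof -
      \<comment> \<open>Two points of the unit circle are at distance at most 2; this is the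
        numerator in \<open>gap_const\<close>.\<close>
      have "cmod (cis ((\<omega> j - \<omega> k) * T) - 1) \<le> 2"
        using norm_triangle_ineq4[of "cis ((\<omega> j - \<omega> k) * T)" 1] by simp
      then have "cmod (J j k) \<le> g j k"
        using that by (simp add: J_def g_def norm_divide norm_mult divide_right_mono del: of_real_diff)
      then have "cmod (a j k * J j k) \<le> (cmod (d j) * cmod (d k)) * g j k"
        by (simp add: a_def norm_mult mult_left_mono)
      also have "\<dots> \<le> (((cmod (d j))\<^sup>2 + (cmod (d k))\<^sup>2) / 2) * g j k"
        using sum_squares_bound[of "cmod (d j)" "cmod (d k)"]
        by (intro mult_right_mono) (auto simp: g_def)
      also have "\<dots> = g j k * ((cmod (d j))\<^sup>2 + (cmod (d k))\<^sup>2) / 2" by simp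
      finally show ?thesis using abs_Re_le_cmod[of "a j k * J j k"] by linarith
    qed
    then have "(\<Sum>k\<in>UNIV - {j}. - (g j k * ((cmod (d j))\<^sup>2 + (cmod (d k))\<^sup>2) / 2))
        \<le> (\<Sum>k\<in>UNIV - {j}. Re (a j k * J j k))"
      by (intro sum_mono) auto
    ultimately show "T * (cmod (d j))\<^sup>2 - (\<Sum>k\<in>UNIV - {j}. g j k * ((cmod (d j))\<^sup>2 + (cmod (d k))\<^sup>2) / 2)
        \<le> Re (a j j * J j j) + (\<Sum>k\<in>UNIV - {j}. Re (a j k * J j k))"
      by (simp add: sum_negf)
  qed
  \<comment> \<open>By the symmetry of \<open>g\<close>, the half charged to \<open>d k\<close> can
    be relabelled as a half charged to \<open>d j\<close>, so each index carries its full row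
    sum.\<close>
  also have "(\<Sum>j\<in>UNIV. T * (cmod (d j))\<^sup>2 -
      (\<Sum>k\<in>UNIV - {j}. g j k * ((cmod (d j))\<^sup>2 + (cmod (d k))\<^sup>2) / 2))
      = (\<Sum>j\<in>UNIV. T * (cmod (d j))\<^sup>2 - (\<Sum>k\<in>UNIV - {j}. g j k) * (cmod (d j))\<^sup>2)"
  proof -
    have "(\<Sum>j\<in>UNIV. \<Sum>k\<in>UNIV - {j}. g j k * (cmod (d k))\<^sup>2 / 2)
        = (\<Sum>k\<in>UNIV. \<Sum>j\<in>UNIV - {k}. g j k * (cmod (d k))\<^sup>2 / 2)"
    proof -
      \<comment> \<open>Diagonal terms may be added and removed freely because
        \<open>g j j = 2 / 0 = 0\<close>; this makes the two index ranges independent for the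
        swap.\<close>
      have "(\<Sum>j\<in>UNIV. \<Sum>k\<in>UNIV - {j}. g j k * (cmod (d k))\<^sup>2 / 2)
        = (\<Sum>j\<in>UNIV. \<Sum>k\<in>UNIV. g j k * (cmod (d k))\<^sup>2 / 2)"
        by (intro sum.cong sum.mono_neutral_left refl) (auto simp: g_def)
      also have "\<dots> = (\<Sum>k\<in>UNIV. \<Sum>j\<in>UNIV. g j k * (cmod (d k))\<^sup>2 / 2)"
        by (rule sum.swap)
      also have "\<dots> = (\<Sum>k\<in>UNIV. \<Sum>j\<in>UNIV - {k}. g j k * (cmod (d k))\<^sup>2 / 2)"
        by (intro sum.cong sum.mono_neutral_right refl) (auto simp: g_def)
      finally show ?thesis .
    qed
    also have "\<dots> = (\<Sum>j\<in>UNIV. \<Sum>k\<in>UNIV - {j}. g j k * (cmod (d j))\<^sup>2 / 2)"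
      by (simp add: g_def abs_minus_commute)
    finally have *: "(\<Sum>j\<in>UNIV. \<Sum>k\<in>UNIV - {j}. g j k * (cmod (d k))\<^sup>2 / 2)
        = (\<Sum>j\<in>UNIV. \<Sum>k\<in>UNIV - {j}. g j k * (cmod (d j))\<^sup>2 / 2)" .
    show ?thesis
      unfolding sum_subtractf ring_distribs add_divide_distrib sum.distrib *
      by (simp add: sum_distrib_right flip: sum.distrib)
  qed
  also have "\<dots> \<ge> (\<Sum>j\<in>UNIV. T * (cmod (d j))\<^sup>2 - gap_const \<omega> * (cmod (d j))\<^sup>2)"
  proof (intro sum_mono diff_left_mono mult_right_mono)
    show "(\<Sum>k\<in>UNIV - {j}. g j k) \<le> gap_const \<omega>" for j
      unfolding gap_const_def g_def by (intro Max_ge) auto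
  qed simp
  finally show ?thesis by (simp add: left_diff_distrib sum_subtractf sum_distrib_left)
qed

subsection \<open>Spectrum of a cyclic skew-symmetric matrix\<close>

definition complex_vec :: "real ^ 'n \<Rightarrow> complex ^ 'n" where
  "complex_vec x = (\<chi> i. complex_of_real (x $ i))"

text \<open>The sesquilinear product, whose real part is the real-valued \<open>inner\<close> on
  \<open>complex ^ 'n\<close>; its phase is needed later.\<close>

definition hdot :: "complex ^ 'n \<Rightarrow> complex ^ 'n \<Rightarrow> complex" where
  "hdot x y = (\<Sum>i\<in>UNIV. cnj (x $ i) * y $ i)"

lemma complex_vec_nth [simp]: "complex_vec x $ i = complex_of_real (x $ i)"
  by (simp add: complex_vec_def)

lemma norm_complex_vec [simp]: "norm (complex_vec x) = norm x"
  by (simp add: norm_vec_def)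

lemma map_matrix_mult_complex_vec:
  "map_matrix complex_of_real A *v complex_vec x = complex_vec (A *v x)"
  by (simp add: vec_eq_iff matrix_vector_mult_def)

lemma map_matrix_power_complex_vec:
  fixes A :: "real ^ 'n ^ 'n"
  shows "((*v) (map_matrix complex_of_real A) ^^ k) (complex_vec x) = complex_vec (((*v) A ^^ k) x)"
  by (induction k) (simp_all add: map_matrix_mult_complex_vec)

lemma hdot_simps:
  "hdot x (y + z) = hdot x y + hdot x z"
  "hdot x (y - z) = hdot x y - hdot x z"
  "hdot x (c *s y) = c * hdot x y"
  "hdot (c *s x) y = cnj c * hdot x y"
  "hdot x 0 = 0"
  "hdot x (- y) = - hdot x y"
  by (simp_all add: hdot_def sum.distrib sum_subtractf sum_distrib_left sum_negf algebra_simps)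

lemma hdot_sum_right: "hdot x (sum f S) = (\<Sum>j\<in>S. hdot x (f j))"
  by (induction S rule: infinite_finite_induct) (simp_all add: hdot_simps)

lemma hdot_self: "hdot x x = complex_of_real ((norm x)\<^sup>2)"
  unfolding hdot_def norm_vec_def L2_set_def
  by (simp add: sum_nonneg complex_mult_cnj cmod_power2 mult.commute)

lemma hdot_skew:
  fixes A :: "real ^ 'n ^ 'n"
  assumes "transpose A = - A"
  shows "hdot x (map_matrix complex_of_real A *v y) = - hdot (map_matrix complex_of_real A *v x) y"
proof -
  have skew: "A $ i $ l = - A $ l $ i" for i l
    using arg_cong[OF assms, of "\<lambda>B. B $ l $ i"] by (simp add: transpose_def)
  have "hdot x (map_matrix complex_of_real A *v y)
      = (\<Sum>i\<in>UNIV. \<Sum>l\<in>UNIV. cnj (x $ i) * (of_real (A $ i $ l) * y $ l))"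
    by (simp add: hdot_def matrix_vector_mult_def sum_distrib_left)
  also have "\<dots> = (\<Sum>l\<in>UNIV. \<Sum>i\<in>UNIV. cnj (x $ i) * (of_real (A $ i $ l) * y $ l))"
    by (rule sum.swap)
  also have "\<dots> = (\<Sum>l\<in>UNIV. \<Sum>i\<in>UNIV. - (of_real (A $ l $ i) * cnj (x $ i) * y $ l))"
    by (intro sum.cong refl) (subst skew, simp)
  also have "\<dots> = - hdot (map_matrix complex_of_real A *v x) y"
    by (simp add: hdot_def matrix_vector_mult_def sum_distrib_right sum_negf)
  finally show ?thesis .
qed

text \<open>Moving \<open>A\<close> across the product of an eigenvector with itself turns
  \<open>l\<close> into \<open>- cnj l\<close>.\<close>

lemma skew_eigenvalue_Re:
  fixes A :: "real ^ 'n ^ 'n"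
  assumes "transpose A = - A" "l \<in> eigenvalues (map_matrix complex_of_real A)"
  shows "Re l = 0"
proof -
  obtain v where v: "v \<noteq> 0" "map_matrix complex_of_real A *v v = l *s v"
    using assms(2) by (auto simp: eigenvalues_def)
  have "(l + cnj l) * hdot v v = 0"
    using hdot_skew[OF assms(1), of v v] by (simp add: v(2) hdot_simps algebra_simps)
  then have "l + cnj l = 0" using v(1) by (simp add: hdot_self)
  then show ?thesis by (simp add: complex_eq_iff)
qed

section \<open>Polynomials in a matrix acting on a vector\<close>

text \<open>Horner evaluation of \<open>p(M) v\<close>. It makes the space a module over polynomials
  without forming any matrix power.\<close>

definition poly_act :: "'a::field ^ 'n ^ 'n \<Rightarrow> 'a poly \<Rightarrow> 'a ^ 'n \<Rightarrow> 'a ^ 'n" where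
  "poly_act M p v = fold_coeffs (\<lambda>c w. c *s v + M *v w) p 0"

lemma poly_act_0 [simp]: "poly_act M 0 v = 0"
  by (simp add: poly_act_def)

lemma poly_act_pCons [simp]: "poly_act M (pCons c p) v = c *s v + M *v poly_act M p v"
  by (cases "c = 0 \<and> p = 0") (auto simp: poly_act_def)

lemma poly_act_add: "poly_act M (p + q) v = poly_act M p v + poly_act M q v"
  by (induction p q rule: poly_induct2)
    (simp_all add: matrix_vector_right_distrib vector_sadd_rdistrib algebra_simps)

lemma poly_act_smult: "poly_act M (smult c p) v = c *s poly_act M p v"
  by (induction p)
    (simp_all add: vector_add_ldistrib vector_scalar_commute vector_smult_assoc)

lemma poly_act_mult: "poly_act M (p * q) v = poly_act M p (poly_act M q v)"
  by (induction p) (simp_all add: poly_act_add poly_act_smult)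

lemma poly_act_sum: "poly_act M (sum f S) v = (\<Sum>i\<in>S. poly_act M (f i) v)"
  by (induction S rule: infinite_finite_induct) (simp_all add: poly_act_add)

lemma poly_act_monom: "poly_act M (monom c k) v = c *s ((*v) M ^^ k) v"
  by (induction k) (simp_all add: monom_0 monom_Suc vector_scalar_commute)

lemma poly_act_linear: "poly_act M ([:- a, 1:] * q) v = M *v poly_act M q v - a *s poly_act M q v"
  unfolding poly_act_mult by (simp add: vector_smult_lneg)

lemma poly_act_altdef:
  assumes "degree p \<le> n"
  shows "poly_act M p v = (\<Sum>k\<le>n. coeff p k *s ((*v) M ^^ k) v)"
  by (subst poly_as_sum_of_monoms'[OF assms, symmetric]) (simp only: poly_act_sum poly_act_monom)

section \<open>Krylov vectors, simplicity of the spectrum and the eigenbasis\<close>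

text \<open>The coefficients are attached to indices rather than to vectors, so repetitions in
  \<open>f\<close> do no harm: a new multiple of \<open>y\<close> is added at one index
  only.\<close>

lemma span_image_sum:
  assumes "finite S" "x \<in> span (f ` S)"
  obtains c where "x = (\<Sum>k\<in>S. c k *\<^sub>R f k)"
proof -
  have "\<exists>c. x = (\<Sum>k\<in>S. c k *\<^sub>R f k)"
    using assms(2)
  proof (induction rule: span_induct_alt)
    case base
    then show ?case by (intro exI[of _ "\<lambda>_. 0"]) simp
  next
    case (step c y z)
    then obtain d j where d: "z = (\<Sum>k\<in>S. d k *\<^sub>R f k)" and j: "j \<in> S" "y = f j" by auto
    have "(\<Sum>k\<in>S. (d k + (if k = j then c else 0)) *\<^sub>R f k) = z + c *\<^sub>R y"
      using assms(1) j by (simp add: d scaleR_add_left sum.distrib if_distrib[of "\<lambda>a. a *\<^sub>R _"] cong: if_cong)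
    then show ?case by (metis add.commute)
  qed
  then show ?thesis using that by blast
qed

text \<open>Counting against the dimension shows that the vectors are distinct and independent;
  distinctness lets independence of the set be read as independence of the indexed family.\<close>

lemma spanning_family_independent:
  fixes f :: "nat \<Rightarrow> real ^ 'n"
  assumes span: "span (f ` {..<CARD('n)}) = UNIV"
    and zero: "(\<Sum>k<CARD('n). c k *\<^sub>R f k) = 0" and k: "k < CARD('n)"
  shows "c k = 0"
proof -
  have "CARD('n) \<le> card (f ` {..<CARD('n)})"
    using dim_le_card'[of "f ` {..<CARD('n)}"] dim_span[of "f ` {..<CARD('n)}"] span by simp
  then have card: "card (f ` {..<CARD('n)}) = CARD('n)"
    using card_image_le[of "{..<CARD('n)}" f] by simp
  then have inj: "inj_on f {..<CARD('n)}" by (simp add: eq_card_imp_inj_on)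
  have "independent (f ` {..<CARD('n)})"
    using card_eq_dim[of "f ` {..<CARD('n)}" UNIV] card span by simp
  moreover have "(\<Sum>v\<in>f ` {..<CARD('n)}. c (the_inv_into {..<CARD('n)} f v) *\<^sub>R v) = 0"
    using zero by (simp add: sum.reindex[OF inj] the_inv_into_f_f[OF inj])
  ultimately have "c (the_inv_into {..<CARD('n)} f (f k)) = 0"
    using k by (auto simp: independent_explicit)
  then show ?thesis using k by (simp add: the_inv_into_f_f[OF inj])
qed

text \<open>The monic polynomial \<open>p\<close> annihilating the cyclic vector plays the part of
  the characteristic polynomial: all its roots are eigenvalues, and a skew matrix has no Jordan
  chain that could produce a double root.\<close>

lemma skew_cyclic_card_eigenvalues:
  fixes A :: "real ^ 'n ^ 'n"
  defines "M \<equiv> map_matrix complex_of_real A"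
  assumes skew: "transpose A = - A" and cyc: "cyclic_matrix A" and fin: "finite (eigenvalues M)"
  shows "CARD('n) \<le> card (eigenvalues M)"
proof -
  let ?n = "CARD('n)"
  obtain b where "span {((*v) A ^^ k) b |k. k < ?n} = UNIV"
    using cyc by (auto simp: cyclic_matrix_def)
  moreover define f where "f = (\<lambda>k. ((*v) A ^^ k) b)"
  ultimately have span: "span (f ` {..<?n}) = UNIV"
    by (simp add: setcompr_eq_image lessThan_def)
  have krylov: "((*v) M ^^ k) (complex_vec b) = complex_vec (f k)" for k
    by (simp add: M_def f_def map_matrix_power_complex_vec)
  \<comment> \<open>Real and imaginary parts of the coefficients would give two real relations among
    the Krylov vectors, which form a basis.\<close>
  have nonzero: "poly_act M q (complex_vec b) \<noteq> 0" if "q \<noteq> 0" "degree q < ?n" for q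
  proof
    assume "poly_act M q (complex_vec b) = 0"
    then have "(\<Sum>k\<le>?n - 1. coeff q k *s complex_vec (f k)) = 0"
      using that(2) by (subst (asm) poly_act_altdef[of q "?n - 1"]) (auto simp: krylov)
    then have sum0: "(\<Sum>k<?n. coeff q k *s complex_vec (f k)) = 0"
      by (simp add: lessThan_Suc_atMost[symmetric])
    have "(\<Sum>k<?n. Re (coeff q k) *\<^sub>R f k) = 0"
      unfolding vec_eq_iff
    proof
      show "(\<Sum>k<?n. Re (coeff q k) *\<^sub>R f k) $ i = 0 $ i" for i
        using arg_cong[OF sum0, of "\<lambda>v. Re (v $ i)"] by simp
    qed
    moreover have "(\<Sum>k<?n. Im (coeff q k) *\<^sub>R f k) = 0"
      unfolding vec_eq_iff
    proof
      show "(\<Sum>k<?n. Im (coeff q k) *\<^sub>R f k) $ i = 0 $ i" for i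
        using arg_cong[OF sum0, of "\<lambda>v. Im (v $ i)"] by simp
    qed
    ultimately have "coeff q k = 0" if "k < ?n" for k
      using spanning_family_independent[OF span, of "\<lambda>k. Re (coeff q k)" k]
        spanning_family_independent[OF span, of "\<lambda>k. Im (coeff q k)" k] that
      by (simp add: complex_eq_iff)
    then have "coeff q (degree q) = 0" using that(2) by blast
    then show False using that(1) by simp
  qed
  \<comment> \<open>The coordinates of \<open>A^n b\<close> in the Krylov basis provide the lower
    coefficients of \<open>p\<close>.\<close>
  obtain c where c: "f ?n = (\<Sum>k<?n. c k *\<^sub>R f k)"
    using span_image_sum[of "{..<?n}" "f ?n" f] span by auto
  define p where "p = monom 1 ?n - (\<Sum>k<?n. monom (complex_of_real (c k)) k)"
  have "degree (\<Sum>k<?n. monom (complex_of_real (c k)) k) < ?n"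
  proof (rule degree_sum_less)
    show "degree (monom (complex_of_real (c k)) k) < ?n" if "k \<in> {..<?n}" for k
      using that degree_monom_le[of "complex_of_real (c k)" k] by simp
  qed simp
  then have deg: "degree p = ?n"
    unfolding p_def by (subst diff_conv_add_uminus, subst degree_add_eq_left)
      (simp_all add: degree_monom_eq)
  then have p0: "p \<noteq> 0" by auto
  have ann: "poly_act M p (complex_vec b) = 0"
  proof -
    have "poly_act M (p + (\<Sum>k<?n. monom (complex_of_real (c k)) k)) (complex_vec b) = complex_vec (f ?n)"
      by (simp add: p_def poly_act_monom krylov)
    moreover have "poly_act M (\<Sum>k<?n. monom (complex_of_real (c k)) k) (complex_vec b) = complex_vec (f ?n)"
      by (simp add: poly_act_sum poly_act_monom krylov c vec_eq_iff)
    ultimately show ?thesis by (simp add: poly_act_add)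
  qed
  have root: "a \<in> eigenvalues M" if "poly p a = 0" for a
  proof -
    \<comment> \<open>Removing the linear factor leaves degree below \<open>n\<close>, so
      \<open>q\<close> does not annihilate the cyclic vector and yields an eigenvector.\<close>
    obtain q where q: "p = [:- a, 1:] * q" using \<open>poly p a = 0\<close> by (auto simp: poly_eq_0_iff_dvd)
    then have "q \<noteq> 0" "degree q < ?n" using p0 deg by (auto simp: degree_mult_eq simp del: mult_pCons_left)
    then have "poly_act M q (complex_vec b) \<noteq> 0" by (rule nonzero)
    moreover have "M *v poly_act M q (complex_vec b) = a *s poly_act M q (complex_vec b)"
      using ann unfolding q poly_act_linear by simp
    ultimately show ?thesis by (auto simp: eigenvalues_def)
  qed
  have "rsquarefree p"
    unfolding rsquarefree_def
  proof (intro conjI allI p0, rule ccontr)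
    fix a assume "\<not> (order a p = 0 \<or> order a p = 1)"
    then have ord: "2 \<le> order a p" by simp
    then have "[:- a, 1:] ^ 2 dvd p" using order_divides by blast
    then obtain r where r: "p = [:- a, 1:] * ([:- a, 1:] * r)"
      by (auto simp: power2_eq_square mult.assoc elim!: dvdE simp del: mult_pCons_left mult_pCons_right)
    \<comment> \<open>A double root gives a chain with \<open>z = (M - a) w\<close> nonzero and
      \<open>(M - a) z = 0\<close>. Skewness then makes \<open>hdot z z\<close> a multiple of
      \<open>a + cnj a\<close>, which vanishes for the imaginary eigenvalue
      \<open>a\<close>.\<close>
    define w where "w = poly_act M r (complex_vec b)"
    define z where "z = M *v w - a *s w"
    have z_alt: "z = poly_act M ([:- a, 1:] * r) (complex_vec b)"
      by (simp only: poly_act_linear z_def w_def)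
    have "r \<noteq> 0" using p0 r by auto
    then have "degree p = Suc (degree ([:- a, 1:] * r))"
      unfolding r by (subst degree_mult_eq) (auto simp del: mult_pCons_left)
    then have "z \<noteq> 0"
      unfolding z_alt using \<open>r \<noteq> 0\<close> deg by (intro nonzero) (auto simp del: mult_pCons_left)
    have Mz: "M *v z = a *s z"
      using ann unfolding r poly_act_linear[of M a "[:- a, 1:] * r"] z_alt by simp
    have "a + cnj a = 0"
      using skew_eigenvalue_Re[OF skew, of a] \<open>z \<noteq> 0\<close> Mz
      by (auto simp: eigenvalues_def M_def complex_eq_iff)
    have "hdot z z = hdot z (M *v w) - a * hdot z w" by (subst (2) z_def) (simp add: hdot_simps)
    also have "\<dots> = - (a + cnj a) * hdot z w"
      using hdot_skew[OF skew, of z w] Mz by (simp add: M_def hdot_simps algebra_simps)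
    finally have "hdot z z = 0" using \<open>a + cnj a = 0\<close> by simp
    then show False using \<open>z \<noteq> 0\<close> by (simp add: hdot_self)
  qed
  \<comment> \<open>Over the complex numbers a squarefree polynomial is a product of distinct linear
    factors, so it has as many roots as its degree.\<close>
  then have "smult (lead_coeff p) (\<Prod>z | poly p z = 0. [:- z, 1:]) = p"
    by (rule complex_poly_decompose_rsquarefree)
  then have "degree p = degree (smult (lead_coeff p) (\<Prod>z | poly p z = 0. [:- z, 1:]))" by simp
  also have "\<dots> = card {z. poly p z = 0}"
    using p0 by (simp add: degree_prod_sum_eq)
  also have "\<dots> \<le> card (eigenvalues M)"
    using root fin by (intro card_mono) auto
  finally show ?thesis using deg by simp
qed

text \<open>This is the Hautus test. By skewness, orthogonality of \<open>u\<close> to one Krylov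
  vector passes to the next; as these span the space, \<open>u\<close> would vanish.\<close>

lemma cyclic_vector_not_orthogonal:
  fixes A :: "real ^ 'n ^ 'n"
  assumes skew: "transpose A = - A" and span: "span {((*v) A ^^ k) b |k. k < CARD('n)} = UNIV"
    and u: "u \<noteq> 0" "map_matrix complex_of_real A *v u = l *s u"
  shows "hdot u (complex_vec b) \<noteq> 0"
proof
  assume 0: "hdot u (complex_vec b) = 0"
  have krylov: "hdot u (complex_vec (((*v) A ^^ k) b)) = 0" for k
  proof (induction k)
    case (Suc k)
    then show ?case
      using hdot_skew[OF skew, of u "complex_vec (((*v) A ^^ k) b)"] u(2)
      by (simp add: map_matrix_mult_complex_vec hdot_simps)
  qed (simp add: 0)
  have all: "hdot u (complex_vec x) = 0" for x
  proof -
    have "x \<in> span {((*v) A ^^ k) b |k. k < CARD('n)}" using span by simp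
    then show ?thesis
    proof (induction rule: span_induct)
      case base
      have "complex_vec (x + y) = complex_vec x + complex_vec y" for x y :: "real ^ 'n"
        by (simp add: vec_eq_iff)
      moreover have "complex_vec (c *\<^sub>R x) = of_real c *s complex_vec x" for c and x :: "real ^ 'n"
        by (simp add: vec_eq_iff)
      moreover have "complex_vec (0 :: real ^ 'n) = 0" by (simp add: vec_eq_iff)
      ultimately show ?case by (auto simp: subspace_def hdot_simps)
    qed (use krylov in auto)
  qed
  have "u $ i = 0" for i
  proof -
    have "hdot u (complex_vec (axis i 1)) = cnj (u $ i)"
      by (simp add: hdot_def axis_def if_distrib[of of_real] if_distrib[of "\<lambda>x. _ * x"] cong: if_cong)
    then show ?thesis using all by simp
  qed
  then show False using u(1) by (simp add: vec_eq_iff)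
qed

lemma skew_cyclic_eigenbasis:
  fixes A :: "real ^ 'n ^ 'n" and \<omega> :: "'n \<Rightarrow> real"
  defines "M \<equiv> map_matrix complex_of_real A"
  assumes skew: "transpose A = - A" and cyc: "cyclic_matrix A"
    and spec: "range (\<lambda>j. \<i> * complex_of_real (\<omega> j)) = eigenvalues M"
  obtains u where "inj \<omega>"
    and "\<And>j. M *v u j = (\<i> * complex_of_real (\<omega> j)) *s u j"
    and "\<And>j k. hdot (u j) (u k) = (if j = k then 1 else 0)"
    and "\<And>i l. (\<Sum>j\<in>UNIV. u j $ i * cnj (u j $ l)) = (if i = l then 1 else 0)"
proof -
  \<comment> \<open>The hypothesis says only that \<omega> enumerates the spectrum as a set; the
    count of eigenvalues turns this into injectivity.\<close>
  have "finite (eigenvalues M)" using spec by (metis finite finite_imageI)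
  then have "CARD('n) \<le> card (range (\<lambda>j. \<i> * complex_of_real (\<omega> j)))"
    using skew_cyclic_card_eigenvalues[OF skew cyc] spec by (simp add: M_def)
  then have "inj (\<lambda>j. \<i> * complex_of_real (\<omega> j))"
    by (intro eq_card_imp_inj_on antisym card_image_le) simp_all
  then have inj: "inj \<omega>" by (auto simp: inj_def)
  have "\<exists>v. norm v = 1 \<and> M *v v = (\<i> * complex_of_real (\<omega> j)) *s v" for j
  proof -
    have "\<i> * complex_of_real (\<omega> j) \<in> eigenvalues M" using spec by blast
    then obtain v where v: "v \<noteq> 0" "M *v v = (\<i> * complex_of_real (\<omega> j)) *s v"
      by (auto simp: eigenvalues_def)
    have "complex_of_real (1 / norm v) *s v = (1 / norm v) *\<^sub>R v"
      by (simp add: vec_eq_iff scaleR_conv_of_real[where 'a = complex])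
    then have "norm (complex_of_real (1 / norm v) *s v) = 1" using v(1) by simp
    moreover have "M *v (complex_of_real (1 / norm v) *s v)
        = (\<i> * complex_of_real (\<omega> j)) *s (complex_of_real (1 / norm v) *s v)"
      by (simp add: vector_scalar_commute v(2) vector_smult_assoc mult.commute)
    ultimately show ?thesis by blast
  qed
  then obtain u where u: "\<And>j. norm (u j) = 1"
    and eig: "\<And>j. M *v u j = (\<i> * complex_of_real (\<omega> j)) *s u j" by metis
  have orth: "hdot (u j) (u k) = (if j = k then 1 else 0)" for j k
  proof (cases "j = k")
    case True
    then show ?thesis by (simp add: hdot_self u)
  next
    case False
    have "\<i> * of_real (\<omega> k) * hdot (u j) (u k) = \<i> * of_real (\<omega> j) * hdot (u j) (u k)"
      using hdot_skew[OF skew, of "u j" "u k"] eig[of j] eig[of k] by (simp add: M_def hdot_simps)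
    then show ?thesis using False inj by (auto simp: inj_eq)
  qed
  \<comment> \<open>The columns of \<open>U\<close> are the eigenvectors and \<open>V\<close> is its
    conjugate transpose. Orthonormality is \<open>V ** U = mat 1\<close>; for square matrices the
    reversed product follows, and its entries are the completeness relation.\<close>
  define U :: "complex ^ 'n ^ 'n" where "U = (\<chi> i j. u j $ i)"
  define V :: "complex ^ 'n ^ 'n" where "V = (\<chi> j i. cnj (u j $ i))"
  have "V ** U = mat 1"
    using orth by (simp add: vec_eq_iff matrix_matrix_mult_def U_def V_def mat_def hdot_def)
  then have "U ** V = mat 1" by (simp add: matrix_left_right_inverse)
  then have "(\<Sum>j\<in>UNIV. u j $ i * cnj (u j $ l)) = (if i = l then 1 else 0)" for i l
    by (simp add: vec_eq_iff matrix_matrix_mult_def U_def V_def mat_def)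
  with inj eig orth show ?thesis using that by blast
qed

subsection \<open>Gramians in the eigenbasis\<close>

locale skew_eigenbasis =
  fixes A :: "real ^ 'n ^ 'n" and \<omega> :: "'n \<Rightarrow> real" and u :: "'n \<Rightarrow> complex ^ 'n"
  assumes skew: "transpose A = - A"
    and inj: "inj \<omega>"
    and eig: "\<And>j. map_matrix complex_of_real A *v u j = (\<i> * complex_of_real (\<omega> j)) *s u j"
    and orth: "\<And>j k. hdot (u j) (u k) = (if j = k then 1 else 0)"
    and complete: "\<And>i l. (\<Sum>j\<in>UNIV. u j $ i * cnj (u j $ l)) = (if i = l then 1 else 0)"
begin

section \<open>Coordinates and the matrix exponential in the eigenbasis\<close>

lemma expansion: "v = (\<Sum>j\<in>UNIV. hdot (u j) v *s u j)"
proof -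
  have "(\<Sum>j\<in>UNIV. hdot (u j) v *s u j) $ i = v $ i" for i
  proof -
    have "(\<Sum>j\<in>UNIV. hdot (u j) v *s u j) $ i
        = (\<Sum>j\<in>UNIV. \<Sum>l\<in>UNIV. v $ l * (u j $ i * cnj (u j $ l)))"
      by (simp add: hdot_def sum_distrib_left sum_distrib_right algebra_simps)
    also have "\<dots> = (\<Sum>l\<in>UNIV. v $ l * (\<Sum>j\<in>UNIV. u j $ i * cnj (u j $ l)))"
      by (subst sum.swap) (simp add: sum_distrib_left)
    finally show ?thesis by (simp add: complete if_distrib[of "\<lambda>x. _ * x"] cong: if_cong)
  qed
  then show ?thesis by (simp add: vec_eq_iff)
qed

lemma parseval: "(\<Sum>j\<in>UNIV. (cmod (hdot (u j) v))\<^sup>2) = (norm v)\<^sup>2"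
proof -
  have "hdot v v = (\<Sum>j\<in>UNIV. hdot (u j) v * hdot v (u j))"
    by (subst (2) expansion) (simp add: hdot_sum_right hdot_simps)
  also have "\<dots> = (\<Sum>j\<in>UNIV. hdot (u j) v * cnj (hdot (u j) v))"
    by (simp add: hdot_def mult.commute)
  finally have "complex_of_real ((norm v)\<^sup>2) = complex_of_real (\<Sum>j\<in>UNIV. (cmod (hdot (u j) v))\<^sup>2)"
    by (simp only: hdot_self complex_norm_square[symmetric] of_real_sum)
  then show ?thesis by (simp only: of_real_eq_iff)
qed

lemma power_entry:
  "complex_of_real (((**) A ^^ k) (mat 1) $ i $ l)
    = (\<Sum>j\<in>UNIV. u j $ i * (\<i> * of_real (\<omega> j)) ^ k * cnj (u j $ l))"
proof (induction k arbitrary: i)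
  case 0
  then show ?case by (simp add: complete mat_def)
next
  case (Suc k)
  have "complex_of_real (((**) A ^^ Suc k) (mat 1) $ i $ l)
      = (\<Sum>m\<in>UNIV. of_real (A $ i $ m) * (\<Sum>j\<in>UNIV. u j $ m * (\<i> * of_real (\<omega> j)) ^ k * cnj (u j $ l)))"
    by (simp add: matrix_matrix_mult_def Suc.IH)
  also have "\<dots> = (\<Sum>m\<in>UNIV. \<Sum>j\<in>UNIV. (of_real (A $ i $ m) * u j $ m) * ((\<i> * of_real (\<omega> j)) ^ k * cnj (u j $ l)))"
    by (simp only: sum_distrib_left mult.assoc)
  also have "\<dots> = (\<Sum>j\<in>UNIV. (\<Sum>m\<in>UNIV. of_real (A $ i $ m) * u j $ m) * ((\<i> * of_real (\<omega> j)) ^ k * cnj (u j $ l)))"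
    by (subst sum.swap) (simp only: sum_distrib_right)
  also have "\<dots> = (\<Sum>j\<in>UNIV. (\<i> * of_real (\<omega> j)) * u j $ i * ((\<i> * of_real (\<omega> j)) ^ k * cnj (u j $ l)))"
  proof (rule sum.cong[OF refl])
    fix j
    have "(\<Sum>m\<in>UNIV. of_real (A $ i $ m) * u j $ m) = (\<i> * of_real (\<omega> j)) * u j $ i"
      using arg_cong[OF eig[of j], of "\<lambda>v. v $ i"] by (simp add: matrix_vector_mult_def)
    then show "(\<Sum>m\<in>UNIV. of_real (A $ i $ m) * u j $ m) * ((\<i> * of_real (\<omega> j)) ^ k * cnj (u j $ l))
        = (\<i> * of_real (\<omega> j)) * u j $ i * ((\<i> * of_real (\<omega> j)) ^ k * cnj (u j $ l))" by simp
  qed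
  finally show ?case by (simp add: algebra_simps)
qed

text \<open>The entries of \<open>U diag(exp(i \<omega> t)) U*\<close>, the candidate for the
  exponential. They are typed as complex since the single summands need not be real.\<close>

definition flow :: "real \<Rightarrow> 'n \<Rightarrow> 'n \<Rightarrow> complex" where
  "flow t i l = (\<Sum>j\<in>UNIV. u j $ i * cis (\<omega> j * t) * cnj (u j $ l))"

lemma scaled_power: "((**) (t *\<^sub>R A) ^^ k) (mat 1) = t ^ k *\<^sub>R ((**) A ^^ k) (mat 1)"
  by (induction k) (simp_all add: matrix_scalar_ac scalar_matrix_assoc[symmetric])

lemma flow_sums:
  "(\<lambda>k. complex_of_real (((1 / fact k) *\<^sub>R ((**) (t *\<^sub>R A) ^^ k) (mat 1)) $ i $ l)) sums flow t i l"
proof -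
  have eq: "complex_of_real (((1 / fact k) *\<^sub>R ((**) (t *\<^sub>R A) ^^ k) (mat 1)) $ i $ l)
      = (\<Sum>j\<in>UNIV. u j $ i * ((\<i> * of_real (\<omega> j * t)) ^ k /\<^sub>R fact k) * cnj (u j $ l))" for k
    unfolding scaled_power
    by (simp add: power_entry sum_distrib_left scaleR_conv_of_real[where 'a = complex]
        power_mult_distrib field_simps)
  show ?thesis
    unfolding eq flow_def cis_conv_exp by (intro sums_sum sums_mult sums_mult2 exp_converges)
qed

text \<open>The entry is the limit of a series with real terms.\<close>

lemma flow_real: "flow t i l = complex_of_real (Re (flow t i l))"
proof -
  have "(\<lambda>k. 0) sums Im (flow t i l)"
    using sums_Im[OF flow_sums[of t i l]] by (simp only: Im_complex_of_real)
  then have "Im (flow t i l) = 0" using sums_unique2 sums_zero by blast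
  then show ?thesis by (simp add: complex_eq_iff)
qed

lemma mexp_flow: "mexp (t *\<^sub>R A) = (\<chi> i l. Re (flow t i l))"
proof -
  have "(\<lambda>k. (1 / fact k) *\<^sub>R ((**) (t *\<^sub>R A) ^^ k) (mat 1)) sums (\<chi> i l. Re (flow t i l))"
    unfolding sums_def
  proof (intro vec_tendstoI)
    fix i l
    show "(\<lambda>n. (\<Sum>k<n. (1 / fact k) *\<^sub>R ((**) (t *\<^sub>R A) ^^ k) (mat 1)) $ i $ l)
        \<longlonglongrightarrow> (\<chi> i l. Re (flow t i l)) $ i $ l"
      using sums_Re[OF flow_sums[of t i l]]
      by (simp only: Re_complex_of_real sums_def sum_component vec_lambda_beta)
  qed
  then show ?thesis unfolding mexp_def by (rule sums_unique[symmetric])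
qed

lemma mexp_entry: "complex_of_real (mexp (t *\<^sub>R A) $ i $ l) = flow t i l"
  by (simp add: mexp_flow flow_real[symmetric])

text \<open>By skewness the left side is the exponential at \<open>- t\<close>, and reversing time
  conjugates and transposes \<open>flow\<close>.\<close>

lemma mexp_transpose: "mexp (t *\<^sub>R transpose A) = transpose (mexp (t *\<^sub>R A))"
proof -
  have "Re (flow (- t) i l) = Re (flow t l i)" for i l
  proof -
    have "flow (- t) i l = cnj (flow t l i)"
      by (simp add: flow_def cis_cnj mult.commute mult.left_commute)
    then show ?thesis by simp
  qed
  moreover have "t *\<^sub>R transpose A = (- t) *\<^sub>R A" by (simp add: skew)
  ultimately show ?thesis by (simp only: mexp_flow) (simp add: vec_eq_iff transpose_def)
qed

lemma mexp_orthogonal: "mexp (t *\<^sub>R A) ** transpose (mexp (t *\<^sub>R A)) = mat 1"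
proof -
  have "(mexp (t *\<^sub>R A) ** transpose (mexp (t *\<^sub>R A))) $ i $ l = (if i = l then 1 else 0)" for i l
  proof -
    have "complex_of_real ((mexp (t *\<^sub>R A) ** transpose (mexp (t *\<^sub>R A))) $ i $ l)
        = (\<Sum>m\<in>UNIV. flow t i m * cnj (flow t l m))"
      by (simp add: matrix_matrix_mult_def transpose_def flip: mexp_entry)
    also have "\<dots> = (\<Sum>m\<in>UNIV. \<Sum>j\<in>UNIV. \<Sum>k\<in>UNIV.
        (u j $ i * cis (\<omega> j * t) * cnj (cis (\<omega> k * t) * u k $ l)) * (cnj (u j $ m) * u k $ m))"
      by (simp add: flow_def sum_product algebra_simps)
    \<comment> \<open>Summing over the middle index \<open>m\<close> first produces the products of
      the orthonormal eigenvectors.\<close>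
    also have "\<dots> = (\<Sum>j\<in>UNIV. \<Sum>k\<in>UNIV.
        (u j $ i * cis (\<omega> j * t) * cnj (cis (\<omega> k * t) * u k $ l)) * hdot (u j) (u k))"
      unfolding hdot_def sum_distrib_left
      by (subst sum.swap, rule sum.cong[OF refl], rule sum.swap)
    also have "\<dots> = (\<Sum>j\<in>UNIV. u j $ i * cnj (u j $ l) * (cis (\<omega> j * t) * cnj (cis (\<omega> j * t))))"
      by (simp add: orth if_distrib[of "\<lambda>x. _ * x"] algebra_simps cong: if_cong)
    also have "\<dots> = (if i = l then 1 else 0)"
      by (simp add: cis_cnj cis_mult complete)
    finally show ?thesis by (simp split: if_splits flip: of_real_eq_iff[where 'a = complex])
  qed
  then show ?thesis by (simp add: vec_eq_iff mat_def)
qed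

lemma mexp_transpose_orthogonal: "transpose (mexp (t *\<^sub>R A)) ** mexp (t *\<^sub>R A) = mat 1"
  using mexp_orthogonal matrix_left_right_inverse by blast

lemma norm_mexp_transpose: "norm (transpose (mexp (t *\<^sub>R A)) *v x) = norm x"
proof -
  have "(transpose (mexp (t *\<^sub>R A)) *v x) \<bullet> (transpose (mexp (t *\<^sub>R A)) *v x)
      = x \<bullet> ((mexp (t *\<^sub>R A) ** transpose (mexp (t *\<^sub>R A))) *v x)"
    by (simp only: transpose_matrix_vector[of "mexp (t *\<^sub>R A)" x] dot_lmul_matrix matrix_vector_mul_assoc[symmetric])
  then show ?thesis by (simp add: mexp_orthogonal norm_eq)
qed

lemma continuous_on_mexp: "continuous_on S (\<lambda>t. mexp (t *\<^sub>R A))"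
  unfolding mexp_flow flow_def by (intro continuous_on_vec_lambda continuous_intros)

section \<open>Trace, symmetry and quadratic form of a Gramian\<close>

lemma continuous_on_gramian_integrand:
  "continuous_on S (\<lambda>t. mexp (t *\<^sub>R A) ** X ** mexp (t *\<^sub>R transpose A))"
  unfolding mexp_transpose
  unfolding matrix_matrix_mult_def transpose_def
  by (simp, intro continuous_on_vec_lambda continuous_intros continuous_on_mexp)

text \<open>Trace, transposition and evaluation of the quadratic form are all linear in the matrix,
  so this one lemma moves each of them under the integral.\<close>

lemma linear_gramian:
  fixes h :: "real ^ 'n ^ 'n \<Rightarrow> 'b :: euclidean_space"
  assumes "linear h"
  shows "h (gramian A X T)
    = integral {0..T} (\<lambda>t. h (mexp (t *\<^sub>R A) ** X ** transpose (mexp (t *\<^sub>R A))))"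
  using integral_linear[OF integrable_continuous_real[OF continuous_on_gramian_integrand[of "{0..T}" X]]
      linear_conv_bounded_linear[THEN iffD1, OF assms]]
  by (simp add: gramian_def o_def mexp_transpose)

text \<open>The integrand is a conjugate of \<open>X\<close> by an orthogonal matrix, so its trace
  is constant in time.\<close>

lemma trace_gramian:
  assumes "0 \<le> T"
  shows "trace (gramian A X T) = T * trace X"
proof -
  have "linear (trace :: real ^ 'n ^ 'n \<Rightarrow> real)"
    by (rule linearI) (simp_all add: trace_def sum.distrib sum_distrib_left)
  from linear_gramian[OF this, of X T]
  have "trace (gramian A X T)
      = integral {0..T} (\<lambda>t. trace (transpose (mexp (t *\<^sub>R A)) ** mexp (t *\<^sub>R A) ** X))"
    by (simp add: trace_mul_sym[of "_ ** _" "transpose _"] matrix_mul_assoc)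
  then show ?thesis using assms by (simp add: mexp_transpose_orthogonal)
qed

lemma transpose_gramian:
  assumes "transpose X = X"
  shows "transpose (gramian A X T) = gramian A X T"
proof -
  have "linear (transpose :: real ^ 'n ^ 'n \<Rightarrow> _)"
    by (rule linearI) (simp_all add: vec_eq_iff transpose_def)
  from linear_gramian[OF this, of X T] show ?thesis
    by (simp add: matrix_transpose_mul transpose_transpose assms matrix_mul_assoc gramian_def mexp_transpose)
qed

lemma gramian_quadratic:
  "x \<bullet> (gramian A X T *v x) = integral {0..T} (\<lambda>t.
    (transpose (mexp (t *\<^sub>R A)) *v x) \<bullet> (X *v (transpose (mexp (t *\<^sub>R A)) *v x)))"
proof -
  have "linear (\<lambda>M. x \<bullet> (M *v x))"
    by (rule linearI) (simp_all add: matrix_vector_mult_add_rdistrib inner_add_right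
        scaleR_matrix_vector_assoc[symmetric])
  from linear_gramian[OF this, of X T] show ?thesis
    by (simp only: transpose_matrix_vector dot_lmul_matrix matrix_vector_mul_assoc[symmetric])
qed

lemma gramian_outer_quadratic:
  "x \<bullet> (gramian A (outer b) T *v x)
    = integral {0..T} (\<lambda>t. (b \<bullet> (transpose (mexp (t *\<^sub>R A)) *v x))\<^sup>2)"
  by (simp only: gramian_quadratic outer_quadratic)

lemma gramian_outer_integrable:
  "(\<lambda>t. (b \<bullet> (transpose (mexp (t *\<^sub>R A)) *v x))\<^sup>2) integrable_on {0..T}"
  unfolding inner_vec_def matrix_vector_mult_def transpose_def
  by (simp, intro integrable_continuous_real continuous_intros continuous_on_mexp)

lemma gramian_mat:
  assumes "0 \<le> T"
  shows "gramian A (c *\<^sub>R mat 1) T = (T * c) *\<^sub>R mat 1"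
proof -
  have "mexp (t *\<^sub>R A) ** (c *\<^sub>R mat 1) ** mexp (t *\<^sub>R transpose A) = c *\<^sub>R mat 1" for t
    by (simp add: mexp_transpose mexp_orthogonal matrix_scalar_ac scalar_matrix_assoc[symmetric])
  then show ?thesis using assms by (simp add: gramian_def)
qed

section \<open>The relaxed and the single-input optimum\<close>

lemma lambda_min_gramian_le:
  assumes "psd X" "trace X = 1" "0 \<le> T"
  shows "lambda_min (gramian A X T) \<le> T / CARD('n)"
  using lambda_min_le_trace[OF transpose_gramian[of X T]] assms
  by (simp add: psd_def trace_gramian field_simps)

text \<open>The trace bound is met by a multiple of the identity, whose Gramian is again scalar
  because the exponentials are orthogonal; the maximum is therefore attained.\<close>

lemma gamma_rel_eq:
  assumes "0 \<le> T"
  shows "gamma_rel A T = T / CARD('n)"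
  unfolding gamma_rel_def
proof (rule Greatest_equality)
  let ?X = "(1 / CARD('n)) *\<^sub>R mat 1 :: real ^ 'n ^ 'n"
  have "psd ?X"
    by (simp add: psd_def scaleR_matrix_vector_assoc[symmetric])
      (simp add: vec_eq_iff transpose_def mat_def)
  moreover have "trace ?X = 1" by (simp add: trace_def mat_def)
  moreover have "lambda_min (gramian A ?X T) = T / CARD('n)"
    unfolding gramian_mat[OF assms] lambda_min_scaleR_mat by simp
  ultimately show "\<exists>X :: real ^ 'n ^ 'n. psd X \<and> trace X = 1 \<and> T / CARD('n) = lambda_min (gramian A X T)"
    by metis
qed (use lambda_min_gramian_le assms in auto)

text \<open>Lipschitz dependence on the input vector, which supplies the continuity behind
  \<open>gamma1_attained\<close>. The minimiser \<open>v\<close> for \<open>c\<close> serves as a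
  test vector for \<open>b\<close>, and the difference of squares factors into \<open>b + c\<close>
  and \<open>b - c\<close>.\<close>

lemma lambda_min_gramian_outer_diff:
  assumes "norm b = 1" "norm c = 1" "0 \<le> T"
  shows "lambda_min (gramian A (outer b) T) - lambda_min (gramian A (outer c) T) \<le> 2 * T * norm (b - c)"
proof -
  let ?y = "\<lambda>t v. transpose (mexp (t *\<^sub>R A)) *v v"
  have sym: "transpose (gramian A (outer b) T) = gramian A (outer b) T" for b
    using transpose_gramian psd_outer psd_def by blast
  obtain v where v: "norm v = 1" "lambda_min (gramian A (outer c) T) = v \<bullet> (gramian A (outer c) T *v v)"
    using lambda_min_rayleigh[OF sym] by blast
  have "lambda_min (gramian A (outer b) T) * (v \<bullet> v) \<le> v \<bullet> (gramian A (outer b) T *v v)"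
    using lambda_min_rayleigh[OF sym] by blast
  then have "lambda_min (gramian A (outer b) T) - lambda_min (gramian A (outer c) T)
      \<le> integral {0..T} (\<lambda>t. (b \<bullet> ?y t v)\<^sup>2) - integral {0..T} (\<lambda>t. (c \<bullet> ?y t v)\<^sup>2)"
    using v by (simp add: gramian_outer_quadratic norm_eq_1)
  also have "\<dots> = integral {0..T} (\<lambda>t. (b \<bullet> ?y t v)\<^sup>2 - (c \<bullet> ?y t v)\<^sup>2)"
    by (rule integral_diff[symmetric]) (rule gramian_outer_integrable)+
  also have "\<dots> \<le> integral {0..T} (\<lambda>t. 2 * norm (b - c))"
  proof (rule integral_le)
    show "(b \<bullet> ?y t v)\<^sup>2 - (c \<bullet> ?y t v)\<^sup>2 \<le> 2 * norm (b - c)" for t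
    proof -
      have y: "norm (?y t v) = 1" using v by (simp only: norm_mexp_transpose)
      have "(b \<bullet> ?y t v)\<^sup>2 - (c \<bullet> ?y t v)\<^sup>2 = ((b + c) \<bullet> ?y t v) * ((b - c) \<bullet> ?y t v)"
        by (simp add: inner_add_left inner_diff_left power2_eq_square algebra_simps)
      also have "\<dots> \<le> \<bar>(b + c) \<bullet> ?y t v\<bar> * \<bar>(b - c) \<bullet> ?y t v\<bar>"
        by (simp flip: abs_mult)
      also have "\<dots> \<le> 2 * norm (b - c)"
      proof (rule mult_mono)
        show "\<bar>(b + c) \<bullet> ?y t v\<bar> \<le> 2"
          using Cauchy_Schwarz_ineq2[of "b + c" "?y t v"] norm_triangle_ineq[of b c] assms y by simp
        show "\<bar>(b - c) \<bullet> ?y t v\<bar> \<le> norm (b - c)"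
          using Cauchy_Schwarz_ineq2[of "b - c" "?y t v"] y by simp
      qed simp_all
      finally show ?thesis .
    qed
  qed (intro integrable_diff gramian_outer_integrable integrable_const_ivl)+
  also have "\<dots> = 2 * T * norm (b - c)" using assms(3) by simp
  finally show ?thesis .
qed

text \<open>Compactness of the unit sphere provides the maximiser that determines the value of
  \<open>GREATEST\<close>.\<close>

lemma gamma1_attained:
  assumes "0 \<le> T"
  obtains b where "norm b = 1" "gamma1 A T = lambda_min (gramian A (outer b) T)"
    "\<And>c. norm c = 1 \<Longrightarrow> lambda_min (gramian A (outer c) T) \<le> gamma1 A T"
proof -
  let ?f = "\<lambda>b. lambda_min (gramian A (outer b) T)"
  have "(2 * T)-lipschitz_on (sphere 0 1) ?f"
  proof (rule lipschitz_onI)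
    fix b c :: "real ^ 'n" assume "b \<in> sphere 0 1" "c \<in> sphere 0 1"
    then show "dist (?f b) (?f c) \<le> 2 * T * dist b c"
      using lambda_min_gramian_outer_diff[of b c T] lambda_min_gramian_outer_diff[of c b T] assms
      by (simp add: dist_norm norm_minus_commute abs_le_iff)
  qed (use assms in simp)
  then have "continuous_on (sphere 0 1) ?f" by (rule lipschitz_on_continuous_on)
  moreover have "axis undefined 1 \<in> sphere (0 :: real ^ 'n) 1" by simp
  ultimately obtain b where b: "norm b = 1" and max: "\<And>c. norm c = 1 \<Longrightarrow> ?f c \<le> ?f b"
    using continuous_attains_sup[of "sphere (0 :: real ^ 'n) 1" ?f] by fastforce
  have "gamma1 A T = ?f b"
    unfolding gamma1_def by (rule Greatest_equality) (use b max in auto)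
  then show ?thesis using that b max by auto
qed

text \<open>A unit vector yields a feasible rank-one matrix for the relaxed problem. This is the
  side of the asymptotic estimate that keeps \<open>1 - rho1 A T\<close> nonnegative.\<close>

lemma rho1_le_1:
  assumes "0 < T"
  shows "rho1 A T \<le> 1"
proof -
  obtain b where b: "norm b = 1" "gamma1 A T = lambda_min (gramian A (outer b) T)"
    using gamma1_attained[of T] assms by auto
  then have "gamma1 A T \<le> T / CARD('n)"
    using lambda_min_gramian_le[OF psd_outer, of b T] assms by (simp add: trace_outer)
  then show ?thesis using assms by (simp add: rho1_def gamma_rel_eq field_simps)
qed

section \<open>A real unit vector with coordinates of equal modulus, and the lower bound\<close>

text \<open>As \<open>A\<close> is real, conjugating \<open>u j\<close> gives an eigenvector for the
  conjugate eigenvalue; simplicity makes it a unimodular multiple of a single basis vector. For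
  \<open>\<omega> j = 0\<close> that vector is \<open>u j\<close> itself.\<close>

lemma conjugate_eigenvector:
  fixes j
  defines "v \<equiv> (\<chi> i. cnj (u j $ i))"
  obtains k where "\<omega> k = - \<omega> j" "v = hdot (u k) v *s u k" "cmod (hdot (u k) v) = 1"
proof -
  have norm: "norm v = 1"
  proof -
    have "norm v = norm (u j)" by (simp add: v_def norm_vec_def)
    also have "(norm (u j))\<^sup>2 = 1"
      using orth[of j j] by (simp add: hdot_self del: of_real_power)
    then have "norm (u j) = 1" by (metis norm_ge_zero one_power2 power2_eq_imp_eq zero_le_one)
    finally show ?thesis .
  qed
  have "map_matrix complex_of_real A *v v = (- \<i> * complex_of_real (\<omega> j)) *s v"
  proof -
    have "(map_matrix complex_of_real A *v v) $ i = cnj ((map_matrix complex_of_real A *v u j) $ i)" for i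
      by (simp add: matrix_vector_mult_def v_def)
    then show ?thesis by (simp add: eig vec_eq_iff) (simp add: v_def)
  qed
  then have orthogonal: "\<i> * complex_of_real (\<omega> k + \<omega> j) * hdot (u k) v = 0" for k
    using hdot_skew[OF skew, of "u k" v] by (simp add: eig hdot_simps algebra_simps add_eq_0_iff)
  have "\<exists>k. hdot (u k) v \<noteq> 0"
  proof (rule ccontr)
    assume "\<not> ?thesis"
    then have "v = 0" using expansion[of v] by simp
    then show False using norm by simp
  qed
  then obtain k where k: "hdot (u k) v \<noteq> 0" by blast
  then have \<omega>: "\<omega> k = - \<omega> j" using orthogonal[of k]
    by (simp add: add_eq_0_iff flip: of_real_add)
  have "hdot (u l) v = 0" if "l \<noteq> k" for l
  proof -
    \<comment> \<open>Only one index carries the frequency \<open>- \<omega> j\<close>, so a single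
      coordinate of \<open>v\<close> survives, and Parseval fixes its modulus.\<close>
    have "\<omega> l + \<omega> j \<noteq> 0" using injD[OF inj, of l k] that \<omega> by auto
    then show ?thesis using orthogonal[of l] by (simp flip: of_real_add)
  qed
  then have eq: "v = hdot (u k) v *s u k"
    by (subst expansion) (simp add: sum.remove[of UNIV k])
  have "(cmod (hdot (u k) v))\<^sup>2 = 1"
    using parseval[of v] \<open>\<And>l. l \<noteq> k \<Longrightarrow> hdot (u l) v = 0\<close> norm by (simp add: sum.remove[of UNIV k])
  then have "cmod (hdot (u k) v) = 1" by (metis norm_ge_zero one_power2 power2_eq_imp_eq zero_le_one)
  with \<omega> eq show ?thesis using that by blast
qed

text \<open>
  Fixing the phases of the eigenvectors by the cyclic vector \<open>c\<close> makes complex conjugation permute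
  the summands, so that their sum is real.
\<close>

lemma flat_vector:
  assumes cyc: "\<And>j. hdot (u j) (complex_vec c) \<noteq> 0"
  obtains b where "norm b = 1" "\<And>j. (cmod (hdot (u j) (complex_vec b)))\<^sup>2 = 1 / CARD('n)"
proof -
  define p where "p = (\<lambda>j. hdot (u j) (complex_vec c))"
  \<comment> \<open>Changing the phase of \<open>u j\<close> changes that of
    \<open>sgn (p j)\<close> inversely, so \<open>w j\<close> depends only on the eigenline. Hence
    conjugation sends \<open>w j\<close> exactly to some \<open>w k\<close>, with no leftover
    factor.\<close>
  define w where "w = (\<lambda>j. sgn (p j) *s u j)"
  define \<beta> where "\<beta> = (\<Sum>j\<in>UNIV. w j)"
  have "\<exists>k. \<omega> k = - \<omega> j \<and> (\<forall>i. w k $ i = cnj (w j $ i))" for j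
  proof -
    define v where "v = (\<chi> i. cnj (u j $ i))"
    obtain k where k: "\<omega> k = - \<omega> j" "v = hdot (u k) v *s u k" "cmod (hdot (u k) v) = 1"
      using conjugate_eigenvector[of j] unfolding v_def by blast
    define h where "h = hdot (u k) v"
    have h: "cnj h * h = 1" using k(3) complex_norm_square[of h] by (simp add: h_def mult.commute)
    have "hdot v (complex_vec c) = cnj (p j)"
      by (simp add: v_def p_def hdot_def)
    moreover have "hdot v (complex_vec c) = cnj h * p k"
      by (subst k(2)) (simp add: hdot_simps h_def p_def)
    ultimately have "cnj h * p k = cnj (p j)" by simp
    then have "p k = h * cnj (p j)" using h
      by (metis mult.assoc mult.commute mult.right_neutral)
    moreover have "sgn h = h" using k(3) by (simp add: sgn_div_norm h_def)
    moreover have "sgn (cnj z) = cnj (sgn z)" for z :: complex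
      by (simp add: sgn_div_norm scaleR_conv_of_real)
    ultimately have "sgn (p k) = h * cnj (sgn (p j))" by (simp add: sgn_mult)
    moreover have "cnj (u j $ i) = h * u k $ i" for i
      using arg_cong[OF k(2), of "\<lambda>v. v $ i"] by (simp flip: h_def) (simp add: v_def)
    ultimately show ?thesis using k(1) by (intro exI[of _ k]) (simp add: w_def)
  qed
  then obtain \<sigma> where \<sigma>: "\<And>j. \<omega> (\<sigma> j) = - \<omega> j" "\<And>j i. w (\<sigma> j) $ i = cnj (w j $ i)"
    by metis
  \<comment> \<open>On frequencies \<sigma> acts as negation, and frequencies determine
    indices.\<close>
  have "inj \<sigma>" by (rule injI) (metis \<sigma>(1) inj injD neg_equal_iff_equal)
  then have bij: "bij \<sigma>" by (simp add: bij_def finite_UNIV_inj_surj)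
  have "cnj (\<beta> $ i) = \<beta> $ i" for i
  proof -
    have "cnj (\<beta> $ i) = (\<Sum>j\<in>UNIV. w (\<sigma> j) $ i)" by (simp add: \<beta>_def \<sigma>(2))
    also have "\<dots> = (\<Sum>j\<in>UNIV. w j $ i)"
      using bij by (rule sum.reindex_bij_betw)
    finally show ?thesis by (simp add: \<beta>_def)
  qed
  then have real: "complex_of_real (Re (\<beta> $ i)) = \<beta> $ i" for i
    by (simp add: complex_eq_iff)
  \<comment> \<open>All coordinates of \<beta> in the eigenbasis have modulus one, so its norm is
    the square root of the dimension.\<close>
  define b where "b = (\<chi> i. Re (\<beta> $ i) / sqrt CARD('n))"
  have b: "complex_vec b = complex_of_real (1 / sqrt CARD('n)) *s \<beta>"
    by (simp add: vec_eq_iff b_def real)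
  have "hdot (u j) \<beta> = sgn (p j)" for j
    by (simp add: \<beta>_def w_def hdot_sum_right hdot_simps orth if_distrib[of "\<lambda>x. _ * x"] cong: if_cong)
  then have flat: "(cmod (hdot (u j) (complex_vec b)))\<^sup>2 = 1 / CARD('n)" for j
    using cyc[of j] by (simp add: b hdot_simps norm_mult norm_sgn norm_divide power_divide p_def)
  have "(norm b)\<^sup>2 = (norm (complex_vec b))\<^sup>2" by simp
  also have "\<dots> = 1" unfolding parseval[symmetric] by (simp add: flat)
  finally have "norm b = 1" by (metis norm_ge_zero one_power2 power2_eq_imp_eq zero_le_one)
  then show ?thesis using flat that by blast
qed

text \<open>This writes the integrand of the rank-one Gramian form as the modulus of a trigonometric
  sum, ready for \<open>trig_sum_integral_lower_bound\<close>.\<close>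

lemma inner_mexp_transpose:
  "complex_of_real (b \<bullet> (transpose (mexp (t *\<^sub>R A)) *v x))
    = (\<Sum>j\<in>UNIV. hdot (u j) (complex_vec b) * cnj (hdot (u j) (complex_vec x)) * cis (\<omega> j * t))"
proof -
  have "complex_of_real (b \<bullet> (transpose (mexp (t *\<^sub>R A)) *v x))
      = (\<Sum>i\<in>UNIV. \<Sum>l\<in>UNIV. complex_of_real (b $ i) * (flow t l i * complex_of_real (x $ l)))"
    by (simp add: inner_vec_def matrix_vector_mult_def transpose_def mexp_entry sum_distrib_left
        del: transpose_matrix_vector)
  also have "\<dots> = (\<Sum>i\<in>UNIV. \<Sum>l\<in>UNIV. \<Sum>j\<in>UNIV.
      of_real (b $ i) * (u j $ l * cis (\<omega> j * t) * cnj (u j $ i) * of_real (x $ l)))"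
    by (simp add: flow_def sum_distrib_left sum_distrib_right)
  also have "\<dots> = (\<Sum>j\<in>UNIV. \<Sum>i\<in>UNIV. \<Sum>l\<in>UNIV.
      of_real (b $ i) * (u j $ l * cis (\<omega> j * t) * cnj (u j $ i) * of_real (x $ l)))"
    by (subst (2) sum.swap, subst sum.swap) simp
  also have "\<dots> = (\<Sum>j\<in>UNIV. hdot (u j) (complex_vec b) * cnj (hdot (u j) (complex_vec x)) * cis (\<omega> j * t))"
    unfolding hdot_def cnj_sum sum_product
    unfolding sum_distrib_right
    by (intro sum.cong refl) simp
  finally show ?thesis .
qed

lemma gamma1_lower_bound:
  assumes cyc: "\<And>j. hdot (u j) (complex_vec c) \<noteq> 0" and T: "0 \<le> T"
  shows "(T - gap_const \<omega>) / CARD('n) \<le> gamma1 A T"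
proof -
  obtain b where b: "norm b = 1" "\<And>j. (cmod (hdot (u j) (complex_vec b)))\<^sup>2 = 1 / CARD('n)"
    using flat_vector[OF cyc] by blast
  have "transpose (gramian A (outer b) T) = gramian A (outer b) T"
    using transpose_gramian psd_outer psd_def by blast
  then obtain x where x: "norm x = 1"
    "lambda_min (gramian A (outer b) T) = x \<bullet> (gramian A (outer b) T *v x)"
    using lambda_min_rayleigh by blast
  \<comment> \<open>Since the coordinates of \<open>b\<close> have equal modulus, the squared moduli
    of the \<open>d j\<close> sum to the same value for every unit \<open>x\<close>, in particular
    for the minimiser chosen here.\<close>
  define d where "d = (\<lambda>j. hdot (u j) (complex_vec b) * cnj (hdot (u j) (complex_vec x)))"
  have "(\<Sum>j\<in>UNIV. (cmod (d j))\<^sup>2) = (norm (complex_vec x))\<^sup>2 / CARD('n)"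
    unfolding parseval[symmetric] by (simp add: d_def norm_mult power_mult_distrib b sum_divide_distrib)
  also have "\<dots> = 1 / CARD('n)"
    using x(1) by simp
  finally have "(T - gap_const \<omega>) / CARD('n) = (T - gap_const \<omega>) * (\<Sum>j\<in>UNIV. (cmod (d j))\<^sup>2)"
    by simp
  also have "\<dots> \<le> integral {0..T} (\<lambda>t. (cmod (\<Sum>j\<in>UNIV. d j * cis (\<omega> j * t)))\<^sup>2)"
    using inj T by (rule trig_sum_integral_lower_bound)
  also have "\<dots> = lambda_min (gramian A (outer b) T)"
    unfolding x(2) gramian_outer_quadratic d_def inner_mexp_transpose[symmetric] by simp
  also have "\<dots> \<le> gamma1 A T"
    by (rule gamma1_attained[OF T]) (simp add: b(1))
  finally show ?thesis .
qed

text \<open>The form of a rank-one Gramian integrates a square. This covers small \<open>T\<close>,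
  where \<open>1 - gap_const \<omega> / T\<close> is negative.\<close>

lemma gamma1_nonneg:
  assumes "0 \<le> T"
  shows "0 \<le> gamma1 A T"
proof -
  obtain b where b: "gamma1 A T = lambda_min (gramian A (outer b) T)"
    by (rule gamma1_attained[OF assms])
  have "transpose (gramian A (outer b) T) = gramian A (outer b) T"
    using transpose_gramian psd_outer psd_def by blast
  then obtain x where "lambda_min (gramian A (outer b) T) = x \<bullet> (gramian A (outer b) T *v x)"
    using lambda_min_rayleigh by blast
  then show ?thesis by (simp add: b gramian_outer_quadratic integral_nonneg gramian_outer_integrable
        del: transpose_matrix_vector)
qed

end

theorem proposition4p4:
  fixes A :: "real ^ 'n ^ 'n" and \<omega> :: "'n \<Rightarrow> real"
  assumes "transpose A = - A"
    and "cyclic_matrix A"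
    and "range (\<lambda>j. \<i> * complex_of_real (\<omega> j)) = eigenvalues (map_matrix complex_of_real A)"
  shows "(\<forall>T>0. rho1 A T \<ge> max 0 (1 - gap_const \<omega> / T)) \<and>
         (\<lambda>T. 1 - rho1 A T) \<in> O[at_top](\<lambda>T. inverse T)"
proof -
  obtain u where "inj \<omega>"
    and eig: "\<And>j. map_matrix complex_of_real A *v u j = (\<i> * complex_of_real (\<omega> j)) *s u j"
    and orth: "\<And>j k. hdot (u j) (u k) = (if j = k then 1 else 0)"
    and "\<And>i l. (\<Sum>j\<in>UNIV. u j $ i * cnj (u j $ l)) = (if i = l then 1 else 0)"
    using skew_cyclic_eigenbasis[OF assms] by blast
  then interpret skew_eigenbasis A \<omega> u
    using assms(1) by unfold_locales
  obtain c where c: "span {((*v) A ^^ k) c |k. k < CARD('n)} = UNIV"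
    using assms(2) by (auto simp: cyclic_matrix_def)
  have "u j \<noteq> 0" for j
    using orth[of j j] by (auto simp: hdot_simps)
  then have cyc: "hdot (u j) (complex_vec c) \<noteq> 0" for j
    using cyclic_vector_not_orthogonal[OF assms(1) c _ eig] by blast
  have lower: "max 0 (1 - gap_const \<omega> / T) \<le> rho1 A T" if "0 < T" for T
  proof -
    have "0 \<le> rho1 A T"
      using gamma1_nonneg[of T] that by (simp add: rho1_def gamma_rel_eq)
    moreover have "1 - gap_const \<omega> / T = (T - gap_const \<omega>) / CARD('n) / (T / CARD('n))"
      using that by (simp add: field_simps)
    moreover have "\<dots> \<le> rho1 A T"
      unfolding rho1_def gamma_rel_eq[OF less_imp_le[OF that]]
      using that by (intro divide_right_mono gamma1_lower_bound[OF cyc]) simp_all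
    ultimately show ?thesis by simp
  qed
  have "(\<lambda>T. 1 - rho1 A T) \<in> O[at_top](\<lambda>T. inverse T)"
  \<comment> \<open>The constant is the gap constant itself, since \<open>1 - rho1 A T\<close> lies
    between \<open>0\<close> and \<open>gap_const \<omega> / T\<close>.\<close>
  proof (rule bigoI[where c = "gap_const \<omega>"])
    show "\<forall>\<^sub>F T in at_top. norm (1 - rho1 A T) \<le> gap_const \<omega> * norm (inverse T)"
      using eventually_gt_at_top[of 0]
    proof eventually_elim
      case (elim T)
      then show ?case
        using lower[of T] rho1_le_1[of T] by (simp add: divide_inverse)
    qed
  qed
  with lower show ?thesis by blast
qed

end
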